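(* Let $\tau>-1$ be a real number and let $n\in\mathbb{N}_0$. Then the Reiswich polynomial $R^\tau_n$ has exactly $n$ pairwise different real roots in the open interval $]0,1[$.
   Context: For $r\in\mathbb{N}_0$ the falling factorial is $[\![\,z\,]\!]_r:=z(z-1)\cdots(z-r+1)$, with $[\![\,z\,]\!]_0:=1$. For $n\in\mathbb{N}_0$ and real $\tau>-1$ the Reiswich polynomial $R^\tau_n\in\mathbb{R}[x]$ is $$ R^\tau_n(x):=\sum_{r=0}^n(-1)^r\binom{n}{r}\frac{[\![\,n+\tau\,]\!]_r}{[\![\,2n+\tau+1\,]\!]_r}\,x^{n-r}. $$ *)

theory Defs
  imports Complex_Main "HOL-Computational_Algebra.Polynomial"
begin

definition falling_fact :: "'a::comm_ring_1 \<Rightarrow> nat \<Rightarrow> 'a" where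
  "falling_fact z r = (\<Prod>i<r. z - of_nat i)"

(* For \<tau> > -1 and r \<le> n every factor 2 n + \<tau> + 1 - i (i < r) of the denominator is
   positive, so no division by zero occurs. *)
definition reiswich_poly :: "real \<Rightarrow> nat \<Rightarrow> real poly" where
  "reiswich_poly \<tau> n =
     (\<Sum>r\<le>n. monom ((- 1) ^ r * real (n choose r) *
        (falling_fact (real n + \<tau>) r / falling_fact (2 * real n + \<tau> + 1) r)) (n - r))"

end

(* Put a = n + \<tau> and b = n + 1. Rodrigues' formula: the k-th derivative of x^a (1 - x)^b is, up to
   a nonzero constant, x^(a - k) (1 - x)^(b - k) Q_k(x), where the coefficient of x^(k - r) in Q_k is
   (-1)^r (k choose r) [[a]]_r / [[a + b]]_r; in particular Q_n is the Reiswich polynomial.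
   As long as a - k and b - k are positive, the product vanishes at 0, at 1 and at the roots of Q_k, so by
   Rolle Q_(k+1) has one root more than Q_k in the open unit interval. *)
theory Submission
  imports Defs
begin

text \<open>The Q_k of the overview, with \<open>m\<close> for a + b. The parameters are decoupled
  from the degree \<open>k\<close> so that they stay fixed during the induction on
  \<open>k\<close>.\<close>

definition rodrigues_poly :: "real \<Rightarrow> real \<Rightarrow> nat \<Rightarrow> real poly" where
  "rodrigues_poly a m k =
     (\<Sum>r\<le>k. monom ((- 1) ^ r * real (k choose r) * (falling_fact a r / falling_fact m r)) (k - r))"

lemma falling_fact_0 [simp]: "falling_fact z 0 = 1"
  by (simp add: falling_fact_def)

lemma falling_fact_Suc: "falling_fact z (Suc r) = falling_fact z r * (z - of_nat r)"
  by (simp add: falling_fact_def)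

lemma coeff_rodrigues_poly:
  "coeff (rodrigues_poly a m k) j =
     (if j \<le> k then (- 1) ^ (k - j) * real (k choose j) * (falling_fact a (k - j) / falling_fact m (k - j))
      else 0)"
proof -
  let ?c = "\<lambda>r. (- 1) ^ r * real (k choose r) * (falling_fact a r / falling_fact m r)"
  have "coeff (rodrigues_poly a m k) j = (\<Sum>r\<le>k. if k - r = j then ?c r else 0)"
    by (simp add: rodrigues_poly_def coeff_sum del: times_divide_eq_right)
  \<comment> \<open>For j > k the truncated \<open>k - j\<close> is 0 and would select r = 0; the
    inner conditional cancels that term.\<close>
  also have "\<dots> = (\<Sum>r\<le>k. if r = k - j then (if j \<le> k then ?c (k - j) else 0) else 0)"
    by (intro sum.cong) auto
  also have "\<dots> = (if j \<le> k then ?c (k - j) else 0)"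
    by simp
  finally show ?thesis
    using binomial_symmetric[of j k] by simp
qed

lemma coeff_first_order_operator:
  fixes p :: "real poly"
  shows "coeff ([:u, v:] * p + [:0, 1, -1:] * pderiv p) (Suc i)
    = (u + real (Suc i)) * coeff p (Suc i) + (v - real i) * coeff p i"
  by (cases i) (simp_all add: coeff_pderiv algebra_simps)

text \<open>The derivative step of Rodrigues' formula, freed of powers: with m = a + b, p = a - k, q
  = b - k, the linear factor is p (1 - x) - q x, and x (1 - x) comes from lowering both exponents by
  one. The scalar k - m keeps the polynomials monic.\<close>

lemma rodrigues_poly_Suc:
  fixes a m :: real
  assumes "m > real k"
  shows "[:a - real k, 2 * real k - m:] * rodrigues_poly a m k
           + [:0, 1, -1:] * pderiv (rodrigues_poly a m k)
         = smult (real k - m) (rodrigues_poly a m (Suc k))" (is "?L = ?R")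
proof (rule poly_eqI)
  fix j
  define c where "c r = falling_fact a r / falling_fact m r" for r
  have coeff: "coeff (rodrigues_poly a m l) i
      = (if i \<le> l then (- 1) ^ (l - i) * real (l choose i) * c (l - i) else 0)" for l i
    by (simp only: coeff_rodrigues_poly c_def)
  \<comment> \<open>As r \<le> k < m, the new denominator factor m - r is nonzero and can be
    cleared.\<close>
  have c_Suc: "(a - real r) * c r = (m - real r) * c (Suc r)" if "r \<le> k" for r
    using that assms by (simp add: c_def falling_fact_Suc)
  show "coeff ?L j = coeff ?R j"
  proof (cases j)
    case 0
    have "coeff ?L j = (- 1) ^ k * ((a - real k) * c k)"
      by (simp add: 0 coeff algebra_simps)
    also have "\<dots> = (- 1) ^ k * ((m - real k) * c (Suc k))"
      by (simp only: c_Suc)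
    also have "\<dots> = coeff ?R j"
      by (simp add: 0 coeff algebra_simps)
    finally show ?thesis .
  next
    case (Suc i)
    have lhs: "coeff ?L j = (a - real k + real j) * coeff (rodrigues_poly a m k) j
                   - (m - 2 * real k + real i) * coeff (rodrigues_poly a m k) i"
      unfolding Suc by (subst coeff_first_order_operator) (simp add: algebra_simps)
    consider "i < k" | "i = k" | "i > k"
      by linarith
    then show ?thesis
    proof cases
      case 1
      \<comment> \<open>The two coefficients of Q_k involved carry \<open>c r\<close> and
        \<open>c (Suc r)\<close>; \<open>c_Suc\<close> turns both into multiples of
        \<open>c (Suc r)\<close>, which leaves an identity between binomial coefficients.\<close>
      define r where "r = k - j"
      have r: "k - i = Suc r" "k - j = r" "Suc k - j = Suc r" "r \<le> k" "real r = real k - real j"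
        using 1 Suc by (auto simp: r_def of_nat_diff)
      define B B' where "B = real (k choose j)" and "B' = real (k choose i)"
      have absorb: "real j * B = (real k - real i) * B'"
      proof -
        have "Suc i * (k choose Suc i) = (k - i) * (k choose i)"
          by (metis binomial_absorb_comp binomial_absorption)
        then have "real (Suc i) * B = real (k - i) * B'"
          unfolding B_def B'_def Suc by (metis of_nat_mult)
        then show ?thesis
          using 1 Suc by (simp add: of_nat_diff)
      qed
      have "coeff ?L j = (- 1) ^ r * (B * ((a - real r) * c r) + (m - 2 * real k + real i) * B' * c (Suc r))"
      proof -
        have "j \<le> k" "i \<le> k"
          using 1 Suc by auto
        then show ?thesis
          unfolding lhs coeff r(1,2) B_def[symmetric] B'_def[symmetric]
          by (simp add: r(5) algebra_simps)
      qed
      also have "B * ((a - real r) * c r) + (m - 2 * real k + real i) * B' * c (Suc r)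
          = ((m - real r) * B + (m - 2 * real k + real i) * B') * c (Suc r)"
        unfolding c_Suc[OF r(4)] by (simp add: algebra_simps)
      \<comment> \<open>Here m - r = (m - k) + j, and \<open>absorb\<close> moves the surplus j B
        over to B'. Pascal's rule then merges B + B'.\<close>
      also have "(m - real r) * B + (m - 2 * real k + real i) * B' = (m - real k) * (B + B')"
        using absorb by (simp add: r(5) algebra_simps)
      also have "(- 1) ^ r * ((m - real k) * (B + B') * c (Suc r)) = coeff ?R j"
      proof -
        have "real (Suc k choose j) = B + B'"
          by (simp add: Suc B_def B'_def)
        moreover have "j \<le> Suc k"
          using 1 Suc by simp
        ultimately show ?thesis
          unfolding coeff_smult coeff r(3) by (simp add: algebra_simps)
      qed
      finally show ?thesis .
    next
      \<comment> \<open>The leading coefficient, of x^(k + 1): only the term from x^k survives, with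
        factor k - m.\<close>
      case 2
      then show ?thesis
        unfolding lhs by (simp add: Suc coeff algebra_simps)
    next
      case 3
      then show ?thesis
        unfolding lhs by (simp add: Suc coeff)
    qed
  qed
qed

text \<open>Induction adding a new largest zero: Rolle between the old and the new maximum gives a
  point beyond all earlier ones. Differentiability is asked only in the open interval because the
  powers in the application may fail to be differentiable at 0 and 1.\<close>

lemma Rolle_finite_zeros:
  fixes f :: "real \<Rightarrow> real"
  assumes "finite T" "T \<noteq> {}" "T \<subseteq> {a..b}"
    and "\<And>x. x \<in> T \<Longrightarrow> f x = 0"
    and "continuous_on {a..b} f"
    and "\<And>x. x \<in> {a<..<b} \<Longrightarrow> (f has_real_derivative f' x) (at x)"
  shows "\<exists>S \<subseteq> {Min T<..<Max T}. finite S \<and> Suc (card S) = card T \<and> (\<forall>x\<in>S. f' x = 0)"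
  using assms(1-4)
proof (induction T rule: finite_linorder_max_induct)
  case empty
  then show ?case by simp
next
  case (insert y T)
  show ?case
  proof (cases "T = {}")
    case True
    then show ?thesis by (intro exI[of _ "{}"]) auto
  next
    case False
    with insert obtain S where S: "S \<subseteq> {Min T<..<Max T}" "finite S" "Suc (card S) = card T"
      "\<forall>x\<in>S. f' x = 0"
      by auto
    define u where "u = Max T"
    have u: "u \<in> T" "u < y"
      using insert False by (auto simp: u_def)
    have "Min T \<le> u"
      using insert u by simp
    have ab: "a \<le> u" "y \<le> b"
      using insert.prems u by auto
    have "\<exists>z. u < z \<and> z < y \<and> f' z = 0"
    proof -
      have "\<exists>z>u. z < y \<and> (*) (f' z) = (\<lambda>v. 0)"
      proof (rule Rolle_deriv[OF u(2)])
        show "f u = f y"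
          using insert.prems u by simp
        show "continuous_on {u..y} f"
          using ab by (intro continuous_on_subset[OF assms(5)]) auto
        show "(f has_derivative (*) (f' x)) (at x)" if "u < x" "x < y" for x
          using assms(6)[of x] that ab by (simp add: has_field_derivative_def)
      qed
      then show ?thesis
        \<comment> \<open>The derivative is the zero linear map; evaluating it at 1 gives
          \<open>f' z = 0\<close>.\<close>
        by (metis mult.right_neutral)
    qed
    then obtain z where z: "u < z" "z < y" "f' z = 0"
      by auto
    have "Max (insert y T) = y" "Min (insert y T) = Min T"
      using insert False u \<open>Min T \<le> u\<close> by (auto intro!: Max_eqI less_imp_le)
    moreover have "insert z S \<subseteq> {Min T<..<y}"
      using S(1) z u \<open>Min T \<le> u\<close> by (force simp: u_def[symmetric])
    moreover have "z \<notin> S" "y \<notin> T"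
      using S(1) z insert.hyps by (auto simp: u_def)
    ultimately show ?thesis
      using S(2-4) z(3) insert.hyps(1) by (intro exI[of _ "insert z S"]) simp
  qed
qed

text \<open>For k > 0 the hypotheses say that a - j and b - j are positive for all j < k, that is,
  at each differentiation up to the last.\<close>

lemma rodrigues_poly_roots:
  fixes a b :: real
  assumes "real k < a + 1" "real k < b + 1"
  shows "\<exists>S \<subseteq> {0<..<1}. finite S \<and> card S = k \<and> (\<forall>x\<in>S. poly (rodrigues_poly a (a + b) k) x = 0)"
  using assms
proof (induction k)
  case 0
  then show ?case by (intro exI[of _ "{}"]) simp
next
  case (Suc k)
  let ?Q = "rodrigues_poly a (a + b)"
  define p q where "p = a - real k" and "q = b - real k"
  have pq: "p > 0" "q > 0"
    using Suc.prems by (auto simp: p_def q_def)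
  have "real k < a + 1" "real k < b + 1"
    using Suc.prems by auto
  from Suc.IH[OF this] obtain S where S: "S \<subseteq> {0<..<1}" "finite S" "card S = k"
    "\<forall>x\<in>S. poly (?Q k) x = 0"
    by blast
  define f where "f = (\<lambda>x. x powr p * (1 - x) powr q * poly (?Q k) x)"
  define f' where "f' = (\<lambda>x. x powr (p - 1) * (1 - x) powr (q - 1) * ((real k - (a + b)) * poly (?Q (Suc k)) x))"
  let ?T = "insert 0 (insert 1 S)"
  have "\<exists>S' \<subseteq> {Min ?T<..<Max ?T}. finite S' \<and> Suc (card S') = card ?T \<and> (\<forall>x\<in>S'. f' x = 0)"
  proof (rule Rolle_finite_zeros)
    show "finite ?T" "?T \<noteq> {}" "?T \<subseteq> {0..1}"
      using S by auto
    show "f x = 0" if "x \<in> ?T" for x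
      using that S pq by (auto simp: f_def)
    \<comment> \<open>Positive exponents make the powers continuous at the endpoints, where a base
      is 0.\<close>
    show "continuous_on {0..1} f"
      unfolding f_def using pq by (intro continuous_intros continuous_on_powr') auto
    show "(f has_real_derivative f' x) (at x)" if "x \<in> {0<..<1}" for x
    proof -
      have x: "0 < x" "x < 1"
        using that by auto
      have "poly ([:a - real k, 2 * real k - (a + b):] * ?Q k + [:0, 1, -1:] * pderiv (?Q k)) x
          = poly (smult (real k - (a + b)) (?Q (Suc k))) x"
        using Suc.prems by (subst rodrigues_poly_Suc) auto
      then have Q: "(real k - (a + b)) * poly (?Q (Suc k)) x
          = (p * (1 - x) - q * x) * poly (?Q k) x + x * (1 - x) * poly (pderiv (?Q k)) x"
        by (simp add: p_def q_def algebra_simps)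
      \<comment> \<open>Splitting one factor off each power exposes the common factor of both terms
        of the derivative.\<close>
      have pw: "x powr p = x powr (p - 1) * x" "(1 - x) powr q = (1 - x) powr (q - 1) * (1 - x)"
        using x by (simp_all add: powr_diff)
      have "(f has_real_derivative
          (p * x powr (p - 1) * (1 - x) powr q - x powr p * (q * (1 - x) powr (q - 1))) * poly (?Q k) x
          + x powr p * (1 - x) powr q * poly (pderiv (?Q k)) x) (at x)"
        unfolding f_def using x
        by (auto intro!: derivative_eq_intros simp: algebra_simps)
      also have "(p * x powr (p - 1) * (1 - x) powr q - x powr p * (q * (1 - x) powr (q - 1))) * poly (?Q k) x
          + x powr p * (1 - x) powr q * poly (pderiv (?Q k)) x = f' x"
        unfolding f'_def Q pw by (simp add: algebra_simps)
      finally show ?thesis .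
    qed
  qed
  then obtain S' where S': "S' \<subseteq> {Min ?T<..<Max ?T}" "finite S'" "Suc (card S') = card ?T"
    "\<forall>x\<in>S'. f' x = 0"
    by blast
  have "Min ?T = 0"
    by (rule Min_eqI) (use S in auto)
  moreover have "Max ?T = 1"
    by (rule Max_eqI) (use S in auto)
  moreover have "card ?T = Suc (Suc k)"
  proof -
    have "0 \<notin> S" "1 \<notin> S"
      using S(1) by auto
    then show ?thesis
      using S by simp
  qed
  \<comment> \<open>This scalar and, inside the unit interval, both powers are nonzero, so zeros of
    \<open>f'\<close> are roots of Q_(k+1). The k + 2 zeros of \<open>f\<close> yield k + 1 of
    them.\<close>
  moreover have "real k - (a + b) \<noteq> 0"
    using Suc.prems by auto
  ultimately show ?case
    using S' by (intro exI[of _ S']) (fastforce simp: f'_def)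
qed

theorem corollary2p3:
  fixes \<tau> :: real and n :: nat
  assumes "\<tau> > -1"
  shows "finite {x \<in> {0<..<1}. poly (reiswich_poly \<tau> n) x = 0}
       \<and> card {x \<in> {0<..<1}. poly (reiswich_poly \<tau> n) x = 0} = n"
proof -
  let ?Z = "{x \<in> {0<..<1}. poly (reiswich_poly \<tau> n) x = 0}"
  have eq: "reiswich_poly \<tau> n = rodrigues_poly (real n + \<tau>) (real n + \<tau> + (real n + 1)) n"
    by (simp add: reiswich_poly_def rodrigues_poly_def algebra_simps)
  have nz: "reiswich_poly \<tau> n \<noteq> 0"
  proof
    assume "reiswich_poly \<tau> n = 0"
    then have "coeff (reiswich_poly \<tau> n) n = 0" by simp
    \<comment> \<open>The coefficient of x^n is 1.\<close>
    then show False by (simp add: eq coeff_rodrigues_poly)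
  qed
  have "degree (reiswich_poly \<tau> n) \<le> n"
    by (rule degree_le) (simp add: eq coeff_rodrigues_poly)
  then have roots: "finite {x. poly (reiswich_poly \<tau> n) x = 0}" "card {x. poly (reiswich_poly \<tau> n) x = 0} \<le> n"
    using poly_roots_finite[OF nz] card_poly_roots_bound[OF nz] by auto
  have fin: "finite ?Z"
    by (rule finite_subset[OF _ roots(1)]) auto
  have "card ?Z \<le> n"
    by (rule order_trans[OF card_mono[OF roots(1)] roots(2)]) auto
  moreover have "n \<le> card ?Z"
  proof -
    obtain S where "S \<subseteq> {0<..<1}" "card S = n" "\<forall>x\<in>S. poly (reiswich_poly \<tau> n) x = 0"
      \<comment> \<open>With a = n + \<tau>, the condition n < a + 1 is exactly \<tau> > -1.\<close>
      using rodrigues_poly_roots[of n "real n + \<tau>" "real n + 1"] assms by (auto simp: eq)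
    moreover from this have "S \<subseteq> ?Z"
      by blast
    ultimately show ?thesis
      using card_mono[OF fin] by blast
  qed
  ultimately show ?thesis
    using fin by simp
qed

end
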